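(* Let $\{\eta(t)\}_{t\ge 0}$ be a process on $S^{\mathbb T_N}$ with generator $L=\sum_{x\in\mathbb T_N}L_{x,x+1}$ satisfying the basic assumptions (A1)–(A5) and the degree-preserving assumptions (A6.1)–(A6.2) listed in the context, and let $D>0$ be the constant such that $L_{0,1}\eta_0=D(\eta_1-\eta_0)$. For $x\in\mathbb T_N$ let $W_{x,x+1}=L_{x,x+1}\eta_x$ be the instantaneous current between $x$ and $x+1$. Then for all $x\in\mathbb T_N$, $W_{x,x+1}=D(\eta_{x+1}-\eta_x)$, so that the model is of gradient type. Moreover, $L\eta_x=D\Delta\eta_x$, where $\Delta\eta_x=\eta_{x+1}+\eta_{x-1}-2\eta_x$.
   Context: Setting. $\mathbb T_N=\mathbb Z/N\mathbb Z$; $S\subseteq\mathbb R$ is measurable and locally compact; $\mathscr X_N=S^{\mathbb T_N}$ with elements $\eta=(\eta_x)_{x\in\mathbb T_N}$. $C(\mathscr X_N)$ is the space of real continuous functions on $\mathscr X_N$ (vanishing at infinity if $\mathscr X_N$ is not compact) with the sup norm. Shifts: $(\tau_x\eta)_z=\eta_{z+x}$, $\tau_xf(\eta)=f(\tau_x\eta)$. $L=\sum_{x\in\mathbb T_N}L_{x,x+1}$ is an operator with domain $\mathcal D(L)$, where $L_{x,x+1}=\tau_xL_{0,1}\tau_{-x}$, $L_{0,1}$ is a linear operator, and all $L_{x,x+1}$ have domain $\mathcal D(L)$. $\{\eta(t)\}_{t\ge0}$ is a Feller process on $\mathscr X_N$ with generator $L$. $\mathcal P_k$ is the space of polynomials in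 $(\eta_x)_{x\in\mathbb T_N}$ of degree at most $k$. "Gradient type" means that the current is a discrete gradient (difference of translates) of a local function. Natural exponential family: $\{\overline\mu_\lambda\}_{\lambda\in I}$ on $S$ with $\overline\mu_\lambda(ds)=Z_\lambda^{-1}e^{\lambda s}\mu^0(ds)$, where $\mu^0$ is a non-Dirac probability measure on $S$, $Z_\lambda=\int_Se^{\lambda s}\mu^0(ds)$ and $I=\{\lambda\in\mathbb R:Z_\lambda<\infty\}$, required not to be a singleton; $I^o$ is its interior. Basic assumptions: (A1) $L_{0,1}1=0$. (A2) $L_{0,1}(FG)=F\,L_{0,1}G$ if $F,G,FG\in\mathcal D(L)$ and $F$ is a function of $\{\eta_y\}_{y\ne0,1}$ and $\eta_0+\eta_1$. (A3) $L_{0,1}F=\sigma_{0,1}(L_{0,1}\sigma_{0,1}F)$ for $F\in\mathcal D(L)$, where $\sigma_{0,1}F(\eta)=F(\sigma_{0,1}\eta)$ and $\sigma_{0,1}\eta$ is $\eta$ with $\eta_0$ and $\eta_1$ exchanged. (A4) The product measures $\overline\nu_\lambda(d\eta)=\prod_{x\in\mathbb T_N}\overline\mu_\lambda(d\eta_x)$, $\lambda\in I$, are invariant for the process, where $\{\overline\mu_\lambda\}_{\lambda\in I}$ is a natural exponential family on $S$. (A5) $E_{\overline\nu_\lambda}[F(-LF)]\ge0$ for $F\in\mathcal D(L)$. Degree-preserving assumptions: $L_{0,1}$ can act also on polynomials in $\mathcal P_2$ (and (A1)–(A3), the invariance identity $E_{\overline\nu_\lambda}[Lf]=0$, and (A5),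 for $\lambda\in I^o$, are understood to hold also for polynomials in $\mathcal P_2$). For a polynomial $f$ put $M_f(t)=f(\eta(t))-f(\eta(0))-\int_0^tLf(\eta(s))ds$ and $N_f(t)=M_f(t)^2-\int_0^t\big(L(f^2)-2fLf\big)(\eta(s))ds$. (A6.1) $L_{0,1}\eta_0=\mathsf p\eta_0+\mathsf q\eta_1+\mathsf r$ for some $\mathsf p,\mathsf q,\mathsf r\in\mathbb R$, $L_{0,1}\eta_0\not\equiv0$, and for $f\in\mathcal P_1$ the processes $M_f$ and $N_f$ are martingales in the natural filtration. (A6.2) $L_{0,1}(\eta_0\eta_1)=\mathsf a(\eta_0^2+\eta_1^2)+\mathsf b\,\eta_0\eta_1+\mathsf c(\eta_0+\eta_1)+\mathsf d$ for some $\mathsf a,\mathsf b,\mathsf c,\mathsf d\in\mathbb R$, $L_{0,1}(\eta_0\eta_1)\not\equiv0$, and for $f\in\mathcal P_2\setminus\mathcal P_1$ the process $M_f$ is a martingale. (These assumptions imply that $L_{0,1}\eta_0=D(\eta_1-\eta_0)$ for some $D>0$.) *)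

theory Defs
  imports "HOL-Probability.Probability"
begin

section \<open>Configurations on the discrete torus\<close>

text \<open>The torus Z/NZ is represented by the residues 0, ..., N - 1.  A configuration is an extensional
  function on the residues with values in S, and \<open>coord N x\<close> (the function \<open>\<eta>\<^sub>x\<close> of the configuration)
  reads the label modulo N, so that \<open>coord N (x + 1)\<close> and \<open>coord N (x - 1)\<close> are the neighbours of
  \<open>coord N x\<close> on the torus.\<close>

type_synonym config = "int \<Rightarrow> real"
type_synonym obs = "config \<Rightarrow> real"

definition sites :: "nat \<Rightarrow> int set" where
  "sites N = {0..<int N}"

definition configs :: "nat \<Rightarrow> real set \<Rightarrow> config set" where
  "configs N S = (sites N \<rightarrow>\<^sub>E S)"

definition config_top :: "nat \<Rightarrow> real set \<Rightarrow> config topology" where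
  "config_top N S = product_topology (\<lambda>_. top_of_set S) (sites N)"

definition config_algebra :: "nat \<Rightarrow> real set \<Rightarrow> config measure" where
  "config_algebra N S = (\<Pi>\<^sub>M x\<in>sites N. restrict_space borel S)"

definition coord :: "nat \<Rightarrow> int \<Rightarrow> obs" where
  "coord N x = (\<lambda>\<eta>. \<eta> (x mod int N))"

definition shift_config :: "nat \<Rightarrow> int \<Rightarrow> config \<Rightarrow> config" where
  "shift_config N x \<eta> = (\<lambda>z\<in>sites N. coord N (z + x) \<eta>)"

definition shift :: "nat \<Rightarrow> int \<Rightarrow> obs \<Rightarrow> obs" where
  "shift N x F = (\<lambda>\<eta>. F (shift_config N x \<eta>))"

definition swap_config :: "nat \<Rightarrow> config \<Rightarrow> config" where
  "swap_config N \<eta> = \<eta>(0 := coord N 1 \<eta>, 1 mod int N := coord N 0 \<eta>)"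

definition swap :: "nat \<Rightarrow> obs \<Rightarrow> obs" where
  "swap N F = (\<lambda>\<eta>. F (swap_config N \<eta>))"

text \<open>Functions on the configuration space are total functions of which only the values on
  \<open>configs N S\<close> matter; function spaces are closed under changing values elsewhere, and equalities
  of functions are stated pointwise on \<open>configs N S\<close>.\<close>

text \<open>If the configuration space is compact, the condition at infinity is void
  (take \<open>K\<close> to be the whole space).\<close>

definition C0 :: "nat \<Rightarrow> real set \<Rightarrow> obs set" where
  "C0 N S = {F. continuous_map (config_top N S) euclideanreal F \<and>
     (\<forall>e>0. \<exists>K. compactin (config_top N S) K \<and> (\<forall>\<eta>\<in>configs N S - K. \<bar>F \<eta>\<bar> < e))}"

definition poly_space :: "nat \<Rightarrow> real set \<Rightarrow> nat \<Rightarrow> obs set" where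
  "poly_space N S k = {F. \<exists>c. \<forall>\<eta>\<in>configs N S.
     F \<eta> = (\<Sum>\<alpha> | \<alpha> \<in> sites N \<rightarrow>\<^sub>E {0..k} \<and> (\<Sum>x\<in>sites N. \<alpha> x) \<le> k.
              c \<alpha> * (\<Prod>x\<in>sites N. \<eta> x ^ \<alpha> x))}"


section \<open>Operators\<close>

text \<open>The first clause says that \<open>T F\<close> on \<open>X\<close> depends only on the values of \<open>F\<close> on \<open>X\<close>.\<close>

definition linear_operator_on :: "config set \<Rightarrow> obs set \<Rightarrow> (obs \<Rightarrow> obs) \<Rightarrow> bool" where
  "linear_operator_on X V T \<longleftrightarrow>
     (\<forall>F\<in>V. \<forall>G. (\<forall>\<eta>\<in>X. F \<eta> = G \<eta>) \<longrightarrow> (\<forall>\<eta>\<in>X. T F \<eta> = T G \<eta>)) \<and>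
     (\<forall>F\<in>V. \<forall>G\<in>V. \<forall>a b. \<forall>\<eta>\<in>X.
        T (\<lambda>\<xi>. a * F \<xi> + b * G \<xi>) \<eta> = a * T F \<eta> + b * T G \<eta>)"

text \<open>\<open>bond_op N L01 x\<close> is \<open>L\<^sub>x\<^sub>,\<^sub>x\<^sub>+\<^sub>1\<close>.\<close>

definition bond_op :: "nat \<Rightarrow> (obs \<Rightarrow> obs) \<Rightarrow> int \<Rightarrow> obs \<Rightarrow> obs" where
  "bond_op N L01 x F = shift N x (L01 (shift N (- x) F))"

definition gen :: "nat \<Rightarrow> (obs \<Rightarrow> obs) \<Rightarrow> obs \<Rightarrow> obs" where
  "gen N L01 F = (\<lambda>\<eta>. \<Sum>x\<in>sites N. bond_op N L01 x F \<eta>)"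

definition current :: "nat \<Rightarrow> (obs \<Rightarrow> obs) \<Rightarrow> int \<Rightarrow> obs" where
  "current N L01 x = bond_op N L01 x (coord N x)"

text \<open>On a fixed finite torus every function depends on finitely many sites, so the set \<open>\<Lambda>\<close> of sites on
  which the local function depends is made explicit.\<close>

definition gradient_type :: "nat \<Rightarrow> real set \<Rightarrow> (obs \<Rightarrow> obs) \<Rightarrow> int set \<Rightarrow> bool" where
  "gradient_type N S L01 \<Lambda> \<longleftrightarrow>
     (\<exists>h. (\<forall>\<eta>\<in>configs N S. \<forall>\<xi>\<in>configs N S.
             (\<forall>y\<in>\<Lambda>. coord N y \<eta> = coord N y \<xi>) \<longrightarrow> h \<eta> = h \<xi>) \<and>
          (\<forall>x\<in>sites N. \<forall>\<eta>\<in>configs N S.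
             current N L01 x \<eta> = shift N (x + 1) h \<eta> - shift N x h \<eta>))"


section \<open>Feller processes and their generators\<close>

text \<open>A process is given by its laws \<open>Pr \<eta>\<close>, for all initial configurations \<open>\<eta>\<close>, on one measurable space
  \<open>M\<close>, together with the random configurations \<open>Y t\<close> for times \<open>t \<ge> 0\<close>.\<close>

definition semigroup :: "(config \<Rightarrow> 'w measure) \<Rightarrow> (real \<Rightarrow> 'w \<Rightarrow> config) \<Rightarrow> real \<Rightarrow> obs \<Rightarrow> obs" where
  "semigroup Pr Y t F = (\<lambda>\<eta>. \<integral>\<omega>. F (Y t \<omega>) \<partial>Pr \<eta>)"

definition natural_filtration ::
  "nat \<Rightarrow> real set \<Rightarrow> 'w measure \<Rightarrow> (real \<Rightarrow> 'w \<Rightarrow> config) \<Rightarrow> real \<Rightarrow> 'w measure" where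
  "natural_filtration N S M Y t =
     sigma (space M) (\<Union>s\<in>{0..t}. {Y s -` A \<inter> space M | A. A \<in> sets (config_algebra N S)})"

definition cadlag :: "nat \<Rightarrow> real set \<Rightarrow> (real \<Rightarrow> config) \<Rightarrow> bool" where
  "cadlag N S p \<longleftrightarrow> (\<forall>x\<in>sites N.
     (\<forall>t\<ge>0. continuous (at_right t) (\<lambda>s. p s x)) \<and>
     (\<forall>t>0. \<exists>l\<in>S. ((\<lambda>s. p s x) \<longlongrightarrow> l) (at_left t)))"

definition feller_process ::
  "nat \<Rightarrow> real set \<Rightarrow> 'w measure \<Rightarrow> (config \<Rightarrow> 'w measure) \<Rightarrow> (real \<Rightarrow> 'w \<Rightarrow> config) \<Rightarrow> bool" where
  "feller_process N S M Pr Y \<longleftrightarrow>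
     (\<forall>\<eta>\<in>configs N S. prob_space (Pr \<eta>) \<and> sets (Pr \<eta>) = sets M) \<and>
     (\<forall>t\<ge>0. Y t \<in> M \<rightarrow>\<^sub>M config_algebra N S) \<and>
     (\<forall>\<omega>\<in>space M. cadlag N S (\<lambda>t. Y t \<omega>)) \<and>
     (\<forall>\<eta>\<in>configs N S. AE \<omega> in Pr \<eta>. Y 0 \<omega> = \<eta>) \<and>
     (\<forall>\<eta>\<in>configs N S. \<forall>F\<in>C0 N S. \<forall>s\<ge>0. \<forall>t\<ge>0. AE \<omega> in Pr \<eta>.
        real_cond_exp (Pr \<eta>) (natural_filtration N S M Y s) (\<lambda>\<omega>'. F (Y (s + t) \<omega>')) \<omega>
          = semigroup Pr Y t F (Y s \<omega>)) \<and>
     (\<forall>F\<in>C0 N S. \<forall>t\<ge>0. semigroup Pr Y t F \<in> C0 N S) \<and>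
     (\<forall>F\<in>C0 N S. uniform_limit (configs N S) (\<lambda>t. semigroup Pr Y t F) F (at_right 0))"

definition has_generator ::
  "nat \<Rightarrow> real set \<Rightarrow> (config \<Rightarrow> 'w measure) \<Rightarrow> (real \<Rightarrow> 'w \<Rightarrow> config) \<Rightarrow> obs set \<Rightarrow> (obs \<Rightarrow> obs) \<Rightarrow> bool"
where
  "has_generator N S Pr Y Dom L \<longleftrightarrow>
     Dom = {F \<in> C0 N S. \<exists>G. uniform_limit (configs N S)
              (\<lambda>t \<eta>. (semigroup Pr Y t F \<eta> - F \<eta>) / t) G (at_right 0)} \<and>
     (\<forall>F\<in>Dom. uniform_limit (configs N S)
              (\<lambda>t \<eta>. (semigroup Pr Y t F \<eta> - F \<eta>) / t) (L F) (at_right 0))"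

definition martingale :: "'w measure \<Rightarrow> (real \<Rightarrow> 'w measure) \<Rightarrow> (real \<Rightarrow> 'w \<Rightarrow> real) \<Rightarrow> bool" where
  "martingale P Fi Z \<longleftrightarrow>
     (\<forall>t\<ge>0. Z t \<in> borel_measurable (Fi t) \<and> integrable P (Z t)) \<and>
     (\<forall>s\<ge>0. \<forall>t\<ge>s. AE \<omega> in P. real_cond_exp P (Fi s) (Z t) \<omega> = Z s \<omega>)"

definition dynkin :: "(obs \<Rightarrow> obs) \<Rightarrow> (real \<Rightarrow> 'w \<Rightarrow> config) \<Rightarrow> obs \<Rightarrow> real \<Rightarrow> 'w \<Rightarrow> real" where
  "dynkin L Y f t \<omega> = f (Y t \<omega>) - f (Y 0 \<omega>) - (LBINT s:{0..t}. L f (Y s \<omega>))"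

definition dynkin_quadratic :: "(obs \<Rightarrow> obs) \<Rightarrow> (real \<Rightarrow> 'w \<Rightarrow> config) \<Rightarrow> obs \<Rightarrow> real \<Rightarrow> 'w \<Rightarrow> real" where
  "dynkin_quadratic L Y f t \<omega> = (dynkin L Y f t \<omega>)\<^sup>2 -
     (LBINT s:{0..t}. L (\<lambda>\<eta>. (f \<eta>)\<^sup>2) (Y s \<omega>) - 2 * f (Y s \<omega>) * L f (Y s \<omega>))"


section \<open>Natural exponential families\<close>

definition exp_partition :: "real measure \<Rightarrow> real \<Rightarrow> ennreal" where
  "exp_partition \<mu>0 l = (\<integral>\<^sup>+s. ennreal (exp (l * s)) \<partial>\<mu>0)"

definition exp_domain :: "real measure \<Rightarrow> real set" where
  "exp_domain \<mu>0 = {l. exp_partition \<mu>0 l < \<infinity>}"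

definition exp_measure :: "real measure \<Rightarrow> real \<Rightarrow> real measure" where
  "exp_measure \<mu>0 l = density \<mu>0 (\<lambda>s. ennreal (exp (l * s)) / exp_partition \<mu>0 l)"

definition natural_exponential_family :: "real set \<Rightarrow> real measure \<Rightarrow> bool" where
  "natural_exponential_family S \<mu>0 \<longleftrightarrow>
     sets \<mu>0 = sets (restrict_space borel S) \<and> prob_space \<mu>0 \<and>
     (\<forall>s\<in>S. \<mu>0 \<noteq> return (restrict_space borel S) s) \<and>
     (\<forall>l. exp_domain \<mu>0 \<noteq> {l})"

definition product_measure :: "nat \<Rightarrow> real measure \<Rightarrow> real \<Rightarrow> config measure" where
  "product_measure N \<mu>0 l = (\<Pi>\<^sub>M x\<in>sites N. exp_measure \<mu>0 l)"


section \<open>The assumptions on the dynamics\<close>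

text \<open>(A2), (A3) and (A5) are parametrised by the class \<open>V\<close> of functions on which they are required:
  the domain of the generator, or the polynomials of degree at most 2.\<close>

definition A1 :: "nat \<Rightarrow> real set \<Rightarrow> (obs \<Rightarrow> obs) \<Rightarrow> bool" where
  "A1 N S L01 \<longleftrightarrow> (\<forall>\<eta>\<in>configs N S. L01 (\<lambda>_. 1) \<eta> = 0)"

definition function_of_others_and_sum :: "nat \<Rightarrow> real set \<Rightarrow> obs \<Rightarrow> bool" where
  "function_of_others_and_sum N S F \<longleftrightarrow> (\<exists>g. \<forall>\<eta>\<in>configs N S.
     F \<eta> = g (restrict \<eta> (sites N - {0, 1 mod int N})) (coord N 0 \<eta> + coord N 1 \<eta>))"

definition A2 :: "nat \<Rightarrow> real set \<Rightarrow> (obs \<Rightarrow> obs) \<Rightarrow> obs set \<Rightarrow> bool" where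
  "A2 N S L01 V \<longleftrightarrow> (\<forall>F\<in>V. \<forall>G\<in>V.
     (\<lambda>\<xi>. F \<xi> * G \<xi>) \<in> V \<longrightarrow> function_of_others_and_sum N S F \<longrightarrow>
     (\<forall>\<eta>\<in>configs N S. L01 (\<lambda>\<xi>. F \<xi> * G \<xi>) \<eta> = F \<eta> * L01 G \<eta>))"

definition A3 :: "nat \<Rightarrow> real set \<Rightarrow> (obs \<Rightarrow> obs) \<Rightarrow> obs set \<Rightarrow> bool" where
  "A3 N S L01 V \<longleftrightarrow> (\<forall>F\<in>V. swap N F \<in> V \<and>
     (\<forall>\<eta>\<in>configs N S. L01 F \<eta> = swap N (L01 (swap N F)) \<eta>))"

definition A4 ::
  "nat \<Rightarrow> real set \<Rightarrow> (config \<Rightarrow> 'w measure) \<Rightarrow> (real \<Rightarrow> 'w \<Rightarrow> config) \<Rightarrow> real measure \<Rightarrow> bool" where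
  "A4 N S Pr Y \<mu>0 \<longleftrightarrow> natural_exponential_family S \<mu>0 \<and>
     (\<forall>l\<in>exp_domain \<mu>0. \<forall>F\<in>C0 N S. \<forall>t\<ge>0.
        (\<integral>\<eta>. semigroup Pr Y t F \<eta> \<partial>product_measure N \<mu>0 l) = (\<integral>\<eta>. F \<eta> \<partial>product_measure N \<mu>0 l))"

definition A4_poly :: "nat \<Rightarrow> real set \<Rightarrow> (obs \<Rightarrow> obs) \<Rightarrow> real measure \<Rightarrow> bool" where
  "A4_poly N S L01 \<mu>0 \<longleftrightarrow> (\<forall>l\<in>interior (exp_domain \<mu>0). \<forall>f\<in>poly_space N S 2.
     (\<integral>\<eta>. gen N L01 f \<eta> \<partial>product_measure N \<mu>0 l) = 0)"

definition A5 :: "nat \<Rightarrow> (obs \<Rightarrow> obs) \<Rightarrow> real measure \<Rightarrow> real set \<Rightarrow> obs set \<Rightarrow> bool" where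
  "A5 N L01 \<mu>0 I V \<longleftrightarrow> (\<forall>l\<in>I. \<forall>F\<in>V.
     0 \<le> (\<integral>\<eta>. F \<eta> * (- gen N L01 F \<eta>) \<partial>product_measure N \<mu>0 l))"

definition A6_1 ::
  "nat \<Rightarrow> real set \<Rightarrow> 'w measure \<Rightarrow> (config \<Rightarrow> 'w measure) \<Rightarrow> (real \<Rightarrow> 'w \<Rightarrow> config) \<Rightarrow> (obs \<Rightarrow> obs) \<Rightarrow> bool"
where
  "A6_1 N S M Pr Y L01 \<longleftrightarrow>
     (\<exists>p q r. \<forall>\<eta>\<in>configs N S. L01 (coord N 0) \<eta> = p * coord N 0 \<eta> + q * coord N 1 \<eta> + r) \<and>
     (\<exists>\<eta>\<in>configs N S. L01 (coord N 0) \<eta> \<noteq> 0) \<and>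
     (\<forall>f\<in>poly_space N S 1. \<forall>\<eta>\<in>configs N S.
        martingale (Pr \<eta>) (natural_filtration N S M Y) (dynkin (gen N L01) Y f) \<and>
        martingale (Pr \<eta>) (natural_filtration N S M Y) (dynkin_quadratic (gen N L01) Y f))"

definition A6_2 ::
  "nat \<Rightarrow> real set \<Rightarrow> 'w measure \<Rightarrow> (config \<Rightarrow> 'w measure) \<Rightarrow> (real \<Rightarrow> 'w \<Rightarrow> config) \<Rightarrow> (obs \<Rightarrow> obs) \<Rightarrow> bool"
where
  "A6_2 N S M Pr Y L01 \<longleftrightarrow>
     (\<exists>a b c d. \<forall>\<eta>\<in>configs N S. L01 (\<lambda>\<xi>. coord N 0 \<xi> * coord N 1 \<xi>) \<eta>
        = a * ((coord N 0 \<eta>)\<^sup>2 + (coord N 1 \<eta>)\<^sup>2) + b * coord N 0 \<eta> * coord N 1 \<eta>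
          + c * (coord N 0 \<eta> + coord N 1 \<eta>) + d) \<and>
     (\<exists>\<eta>\<in>configs N S. L01 (\<lambda>\<xi>. coord N 0 \<xi> * coord N 1 \<xi>) \<eta> \<noteq> 0) \<and>
     (\<forall>f\<in>poly_space N S 2 - poly_space N S 1. \<forall>\<eta>\<in>configs N S.
        martingale (Pr \<eta>) (natural_filtration N S M Y) (dynkin (gen N L01) Y f))"

end

theory Submission
  imports Defs
begin

text \<open>Only the bonds containing \<open>x\<close> act on \<open>\<eta>\<^sub>x\<close>: by (A2) with \<open>G = 1\<close> and (A1), \<open>L\<^sub>0\<^sub>,\<^sub>1 \<eta>\<^sub>z = 0\<close> for
  \<open>z \<noteq> 0, 1\<close>, while the symmetry (A3) gives \<open>L\<^sub>0\<^sub>,\<^sub>1 \<eta>\<^sub>1 = D (\<eta>\<^sub>0 - \<eta>\<^sub>1)\<close>. Translating, the bonds \<open>(x, x + 1)\<close>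
  and \<open>(x - 1, x)\<close> contribute \<open>D (\<eta>\<^sub>x\<^sub>+\<^sub>1 - \<eta>\<^sub>x)\<close> and \<open>D (\<eta>\<^sub>x\<^sub>-\<^sub>1 - \<eta>\<^sub>x)\<close> to \<open>L \<eta>\<^sub>x\<close>. For \<open>N = 2\<close> these are two
  different bonds joining the same pair of sites; \<open>N = 1\<close> is excluded because then
  \<open>L\<^sub>0\<^sub>,\<^sub>1 \<eta>\<^sub>0\<close> would vanish.\<close>

lemma coord_cong: "x mod int N = y mod int N \<Longrightarrow> coord N x = coord N y"
  by (simp add: coord_def)

lemma mod_in_sites: "N \<ge> 1 \<Longrightarrow> x mod int N \<in> sites N"
  by (simp add: sites_def)

lemma coord_in: "N \<ge> 1 \<Longrightarrow> \<eta> \<in> configs N S \<Longrightarrow> coord N x \<eta> \<in> S"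
  using mod_in_sites[of N x] by (auto simp: coord_def configs_def)

lemma coord_shift_config:
  "N \<ge> 1 \<Longrightarrow> coord N z (shift_config N x \<eta>) = coord N (z + x) \<eta>"
  using mod_in_sites[of N z] by (simp add: coord_def shift_config_def mod_add_left_eq)

lemma shift_coord: "N \<ge> 1 \<Longrightarrow> shift N x (coord N z) = coord N (z + x)"
  by (simp add: shift_def coord_shift_config)

lemma shift_config_in: "N \<ge> 1 \<Longrightarrow> \<eta> \<in> configs N S \<Longrightarrow> shift_config N x \<eta> \<in> configs N S"
  using coord_in[of N \<eta> S] by (auto simp: shift_config_def configs_def)

lemma swap_config_in:
  assumes "N \<ge> 1" "\<eta> \<in> configs N S"
  shows "swap_config N \<eta> \<in> configs N S"
proof -
  have "0 \<in> sites N" "1 mod int N \<in> sites N"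
    using assms mod_in_sites[of N] by (auto simp: sites_def)
  then show ?thesis
    using assms(2) coord_in[OF assms]
    unfolding swap_config_def configs_def by (auto simp: PiE_iff extensional_def)
qed

lemma coord_swap_config:
  assumes "N \<ge> 2"
  shows "coord N 0 (swap_config N \<eta>) = coord N 1 \<eta>" "coord N 1 (swap_config N \<eta>) = coord N 0 \<eta>"
  using assms by (auto simp: coord_def swap_config_def)

text \<open>The indicator of \<alpha> serves as coefficient family, and the finite sum over
  exponents collapses to one term. Constants and coordinates become members of
  \<open>poly_space\<close> through this.\<close>

lemma monomial_in_poly_space:
  assumes "\<alpha> \<in> sites N \<rightarrow>\<^sub>E {0..k}" "(\<Sum>x\<in>sites N. \<alpha> x) \<le> k"
  shows "(\<lambda>\<eta>. \<Prod>x\<in>sites N. \<eta> x ^ \<alpha> x) \<in> poly_space N S k"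
proof -
  let ?E = "{\<alpha>. \<alpha> \<in> sites N \<rightarrow>\<^sub>E {0..k} \<and> (\<Sum>x\<in>sites N. \<alpha> x) \<le> k}"
  have "finite (sites N \<rightarrow>\<^sub>E {0..k})"
    by (intro finite_PiE) (auto simp: sites_def)
  then have fin: "finite ?E"
    by (rule rev_finite_subset) auto
  have "(\<Prod>x\<in>sites N. \<eta> x ^ \<alpha> x)
      = (\<Sum>\<beta>\<in>?E. (if \<beta> = \<alpha> then 1 else 0) * (\<Prod>x\<in>sites N. \<eta> x ^ \<beta> x))" for \<eta> :: config
  proof -
    have "(\<Sum>\<beta>\<in>?E. (if \<beta> = \<alpha> then 1 else 0) * (\<Prod>x\<in>sites N. \<eta> x ^ \<beta> x))
        = (\<Sum>\<beta>\<in>?E. if \<beta> = \<alpha> then \<Prod>x\<in>sites N. \<eta> x ^ \<beta> x else 0)"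
      by (intro sum.cong) auto
    also have "\<dots> = (\<Prod>x\<in>sites N. \<eta> x ^ \<alpha> x)"
      using fin assms by (simp add: sum.delta)
    finally show ?thesis by simp
  qed
  then show ?thesis
    unfolding poly_space_def by (intro CollectI exI[of _ "\<lambda>\<beta>. if \<beta> = \<alpha> then 1 else 0"]) simp
qed

lemma one_in_poly_space: "(\<lambda>_. 1) \<in> poly_space N S k"
  using monomial_in_poly_space[of "\<lambda>x\<in>sites N. 0" N k S] by (simp cong: prod.cong)

lemma coord_in_poly_space:
  assumes "N \<ge> 1" "k \<ge> 1"
  shows "coord N z \<in> poly_space N S k"
proof -
  \<comment> \<open>The unit exponent vector at the residue of \<open>z\<close>, of total degree
    1.\<close>
  let ?\<alpha> = "\<lambda>x\<in>sites N. if x = z mod int N then 1 else (0::nat)"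
  have fin: "finite (sites N)" by (simp add: sites_def)
  have "(\<Prod>x\<in>sites N. \<eta> x ^ ?\<alpha> x) = coord N z \<eta>" for \<eta> :: config
  proof -
    have "(\<Prod>x\<in>sites N. \<eta> x ^ ?\<alpha> x) = (\<Prod>x\<in>sites N. if x = z mod int N then \<eta> x else 1)"
      by (intro prod.cong) auto
    then show ?thesis
      using fin mod_in_sites[OF assms(1)] by (simp add: coord_def)
  qed
  moreover have "(\<Sum>x\<in>sites N. ?\<alpha> x) = 1"
    using fin mod_in_sites[OF assms(1)] by simp
  ultimately show ?thesis
    using monomial_in_poly_space[of ?\<alpha> N k S] assms(2) by simp
qed

text \<open>The class \<open>poly_space N S 2\<close> is the right one for (A2) here: a coordinate
  need not vanish at infinity, so it may lie outside the domain of the generator.\<close>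

lemma L01_coord_other:
  assumes "N \<ge> 1" "A1 N S L01" "A2 N S L01 (poly_space N S 2)"
    and "z mod int N \<noteq> 0" "z mod int N \<noteq> 1 mod int N" "\<eta> \<in> configs N S"
  shows "L01 (coord N z) \<eta> = 0"
proof -
  \<comment> \<open>The witness ignores the sum and reads site \<open>z mod int N\<close>, which
    survives the restriction because it is neither \<open>0\<close> nor
    \<open>1 mod int N\<close>.\<close>
  have "function_of_others_and_sum N S (coord N z)"
    using mod_in_sites[OF assms(1)] assms(4,5)
    unfolding function_of_others_and_sum_def
    by (intro exI[of _ "\<lambda>\<xi> _. \<xi> (z mod int N)"]) (simp add: coord_def)
  moreover have "coord N z \<in> poly_space N S 2" "(\<lambda>\<xi>. coord N z \<xi> * 1) \<in> poly_space N S 2"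
    using coord_in_poly_space[OF assms(1), of 2 z S] by simp_all
  ultimately have "L01 (\<lambda>\<xi>. coord N z \<xi> * 1) \<eta> = coord N z \<eta> * L01 (\<lambda>_. 1) \<eta>"
    using assms(3)[unfolded A2_def, rule_format, of "coord N z" "\<lambda>_. 1" \<eta>]
      one_in_poly_space[of N S 2] assms(6) by blast
  then show ?thesis
    using assms(2,6) by (simp add: A1_def)
qed

lemma L01_coord_1:
  assumes "N \<ge> 2" "A3 N S L01 (poly_space N S 2)"
    and D: "\<And>\<eta>. \<eta> \<in> configs N S \<Longrightarrow> L01 (coord N 0) \<eta> = D * (coord N 1 \<eta> - coord N 0 \<eta>)"
    and \<eta>: "\<eta> \<in> configs N S"
  shows "L01 (coord N 1) \<eta> = D * (coord N 0 \<eta> - coord N 1 \<eta>)"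
proof -
  have "swap N (coord N 1) = coord N 0"
    using assms(1) by (simp add: swap_def coord_swap_config)
  moreover have "L01 (coord N 1) \<eta> = swap N (L01 (swap N (coord N 1))) \<eta>"
    using assms(1,2) \<eta> coord_in_poly_space[of N 2 1 S] by (simp add: A3_def)
  ultimately have "L01 (coord N 1) \<eta> = L01 (coord N 0) (swap_config N \<eta>)"
    by (simp add: swap_def)
  \<comment> \<open>The formula for \<open>L01 (coord N 0)\<close> is evaluated at the swapped
    configuration, which reverses the sign of the difference.\<close>
  also have "\<dots> = D * (coord N 0 \<eta> - coord N 1 \<eta>)"
    using assms(1) \<eta> swap_config_in[of N \<eta> S] by (simp add: D coord_swap_config)
  finally show ?thesis .
qed

text \<open>The inner shift relabels \<open>x\<close> as \<open>x - y\<close>, and the outer one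
  moves the configuration; every bond is thereby reduced to the bond (0, 1).\<close>

lemma bond_op_coord:
  assumes "N \<ge> 1"
  shows "bond_op N L01 y (coord N x) \<eta> = L01 (coord N (x - y)) (shift_config N y \<eta>)"
  using assms by (simp add: bond_op_def shift_coord) (simp add: shift_def)

text \<open>Written as a sum of two indicators in \<open>y\<close>, so that summing over all bonds
  leaves one term from each.\<close>

lemma bond_op_coord_eq:
  assumes N: "N \<ge> 2" and "A1 N S L01" "A2 N S L01 (poly_space N S 2)" "A3 N S L01 (poly_space N S 2)"
    and D: "\<And>\<eta>. \<eta> \<in> configs N S \<Longrightarrow> L01 (coord N 0) \<eta> = D * (coord N 1 \<eta> - coord N 0 \<eta>)"
    and x: "x \<in> sites N" and y: "y \<in> sites N" and \<eta>: "\<eta> \<in> configs N S"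
  shows "bond_op N L01 y (coord N x) \<eta>
    = (if y = x then D * (coord N (x + 1) \<eta> - coord N x \<eta>) else 0)
      + (if y = (x - 1) mod int N then D * (coord N (x - 1) \<eta> - coord N x \<eta>) else 0)"
proof -
  let ?\<xi> = "shift_config N y \<eta>"
  have \<xi>: "?\<xi> \<in> configs N S" and N1: "N \<ge> 1"
    using N \<eta> by (auto intro: shift_config_in)
  have bond: "bond_op N L01 y (coord N x) \<eta> = L01 (coord N (x - y)) ?\<xi>"
    using N1 by (rule bond_op_coord)
  have xy: "0 \<le> x" "x < int N" "0 \<le> y" "y < int N"
    using x y by (auto simp: sites_def)
  \<comment> \<open>At most one indicator is active; for \<open>N = 2\<close> too, the left
    neighbour of \<open>x\<close> differs from \<open>x\<close>.\<close>
  have neq: "(x - 1) mod int N \<noteq> x"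
    using N xy by (cases "x = 0") (auto simp: zmod_minus1)
  consider "y = x" | "y = (x - 1) mod int N" | "y \<noteq> x" "y \<noteq> (x - 1) mod int N" by blast
  then show ?thesis
  proof cases
    case 1
    then show ?thesis
      using bond D[OF \<xi>] neq N1 by (simp add: coord_shift_config add.commute)
  next
    case 2
    have eq: "(x - y) mod int N = 1 mod int N"
      unfolding 2 by (simp add: mod_diff_right_eq)
    then have 1: "coord N (x - y) = coord N 1"
      by (rule coord_cong)
    \<comment> \<open>Seen from bond \<open>y\<close>, the labels 0 and 1 are the sites
      \<open>x - 1\<close> and \<open>x\<close>, so \<open>x\<close> is the right end of the
      bond.\<close>
    have 3: "coord N y = coord N (x - 1)" "coord N (1 + y) = coord N x"
      unfolding 2 by (rule coord_cong; simp add: mod_add_right_eq)+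
    show ?thesis
      using bond L01_coord_1[OF N assms(4) D \<xi>] 1 2 3 neq N1 by (simp add: coord_shift_config)
  next
    case 3
    \<comment> \<open>Both labels are residues, so congruence modulo \<open>N\<close> would force
      equality.\<close>
    have "(x - y) mod int N \<noteq> 0"
      using 3(1) xy by (metis mod_eq_dvd_iff mod_pos_pos_trivial dvd_eq_mod_eq_0)
    moreover have "(x - y) mod int N \<noteq> 1 mod int N"
    proof
      assume "(x - y) mod int N = 1 mod int N"
      then have "int N dvd (x - 1) - y"
        by (simp add: mod_eq_dvd_iff algebra_simps)
      then have "(x - 1) mod int N = y mod int N"
        by (simp add: mod_eq_dvd_iff)
      with 3(2) xy show False by simp
    qed
    ultimately have "L01 (coord N (x - y)) ?\<xi> = 0"
      using L01_coord_other[OF N1 assms(2,3) _ _ \<xi>] by blast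
    with bond 3 show ?thesis by simp
  qed
qed

lemma gen_coord:
  assumes N: "N \<ge> 2" and "A1 N S L01" "A2 N S L01 (poly_space N S 2)" "A3 N S L01 (poly_space N S 2)"
    and D: "\<And>\<eta>. \<eta> \<in> configs N S \<Longrightarrow> L01 (coord N 0) \<eta> = D * (coord N 1 \<eta> - coord N 0 \<eta>)"
    and x: "x \<in> sites N" and \<eta>: "\<eta> \<in> configs N S"
  shows "gen N L01 (coord N x) \<eta>
    = D * (coord N (x + 1) \<eta> + coord N (x - 1) \<eta> - 2 * coord N x \<eta>)"
proof -
  have fin: "finite (sites N)" by (simp add: sites_def)
  have "gen N L01 (coord N x) \<eta> = (\<Sum>y\<in>sites N.
      (if y = x then D * (coord N (x + 1) \<eta> - coord N x \<eta>) else 0)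
      + (if y = (x - 1) mod int N then D * (coord N (x - 1) \<eta> - coord N x \<eta>) else 0))"
    unfolding gen_def using bond_op_coord_eq[OF N assms(2-4) D x _ \<eta>] by (intro sum.cong) auto
  also have "\<dots> = D * (coord N (x + 1) \<eta> - coord N x \<eta>) + D * (coord N (x - 1) \<eta> - coord N x \<eta>)"
    using fin x N mod_in_sites[of N "x - 1"] by (simp add: sum.distrib)
  finally show ?thesis by (simp add: algebra_simps)
qed

lemma current_eq:
  assumes "N \<ge> 1"
    and D: "\<And>\<eta>. \<eta> \<in> configs N S \<Longrightarrow> L01 (coord N 0) \<eta> = D * (coord N 1 \<eta> - coord N 0 \<eta>)"
    and \<eta>: "\<eta> \<in> configs N S"
  shows "current N L01 x \<eta> = D * (coord N (x + 1) \<eta> - coord N x \<eta>)"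
  using assms(1) D[OF shift_config_in[OF assms(1) \<eta>]]
  by (simp add: current_def bond_op_coord coord_shift_config add.commute)

theorem lemma4p1:
  fixes N :: nat
    and S :: "real set"
    and M :: "'w measure"
    and Pr :: "config \<Rightarrow> 'w measure"
    and Y :: "real \<Rightarrow> 'w \<Rightarrow> config"
    and Dom :: "obs set"
    and L01 :: "obs \<Rightarrow> obs"
    and \<mu>0 :: "real measure"
    and D :: real
  assumes N: "N \<ge> 1"
    and S: "S \<in> sets borel" "locally compact S"
    and process: "feller_process N S M Pr Y"
    and generator: "has_generator N S Pr Y Dom (gen N L01)"
    and common_domain: "\<And>x F. F \<in> Dom \<Longrightarrow> shift N x F \<in> Dom"
    and linear: "linear_operator_on (configs N S) Dom L01"
    and linear_poly: "linear_operator_on (configs N S) (poly_space N S 2) L01"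
    and A1: "A1 N S L01"
    and A2: "A2 N S L01 Dom"
    and A2_poly: "A2 N S L01 (poly_space N S 2)"
    and A3: "A3 N S L01 Dom"
    and A3_poly: "A3 N S L01 (poly_space N S 2)"
    and A4: "A4 N S Pr Y \<mu>0"
    and A4_poly: "A4_poly N S L01 \<mu>0"
    and A5: "A5 N L01 \<mu>0 (exp_domain \<mu>0) Dom"
    and A5_poly: "A5 N L01 \<mu>0 (interior (exp_domain \<mu>0)) (poly_space N S 2)"
    and A6_1: "A6_1 N S M Pr Y L01"
    and A6_2: "A6_2 N S M Pr Y L01"
    and D: "D > 0" "\<And>\<eta>. \<eta> \<in> configs N S \<Longrightarrow> L01 (coord N 0) \<eta> = D * (coord N 1 \<eta> - coord N 0 \<eta>)"
  shows "(\<forall>x\<in>sites N. \<forall>\<eta>\<in>configs N S.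
            current N L01 x \<eta> = D * (coord N (x + 1) \<eta> - coord N x \<eta>)) \<and>
         gradient_type N S L01 {0} \<and>
         (\<forall>x\<in>sites N. \<forall>\<eta>\<in>configs N S.
            gen N L01 (coord N x) \<eta>
              = D * (coord N (x + 1) \<eta> + coord N (x - 1) \<eta> - 2 * coord N x \<eta>))"
proof -
  have cur: "current N L01 x \<eta> = D * (coord N (x + 1) \<eta> - coord N x \<eta>)"
    if "\<eta> \<in> configs N S" for x \<eta>
    using N D(2) that by (rule current_eq)
  have "gradient_type N S L01 {0}"
    unfolding gradient_type_def
  \<comment> \<open>The current is the difference of the translates of \<open>D * coord N 0\<close>
    by \<open>x + 1\<close> and \<open>x\<close>; this function reads site 0 only.\<close>
  proof (intro exI[of _ "\<lambda>\<eta>. D * coord N 0 \<eta>"] conjI ballI impI)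
    fix x \<eta> assume "\<eta> \<in> configs N S"
    then show "current N L01 x \<eta>
        = shift N (x + 1) (\<lambda>\<eta>. D * coord N 0 \<eta>) \<eta> - shift N x (\<lambda>\<eta>. D * coord N 0 \<eta>) \<eta>"
      using N by (simp add: cur shift_def coord_shift_config algebra_simps)
  qed simp
  moreover have "N \<noteq> 1"
  proof
    assume "N = 1"
    \<comment> \<open>Modulo 1 the labels 0 and 1 name the same site, which contradicts the
      nonvanishing clause of \<open>A6_1\<close>.\<close>
    then have "L01 (coord N 0) \<eta> = 0" if "\<eta> \<in> configs N S" for \<eta>
      using D(2)[OF that] by (simp add: coord_def)
    with A6_1 show False by (auto simp: A6_1_def)
  qed
  then have "N \<ge> 2" using N by simp
  note gen_coord[OF this A1 A2_poly A3_poly D(2)]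
  ultimately show ?thesis using cur by blast
qed

end
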